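(* Let $\Gamma$ be a countable group with a $\mathcal{C}$-order $\preceq$. For any numbering $(g_n)_{n \geq 0}$ of $\Gamma$, the corresponding dynamical realization of $\preceq$ is a subgroup of $\mathrm{Homeo}_+(\mathbb{R})$ without crossed elements.
   Context: A left-invariant total order $\preceq$ on a group $\Gamma$ is a $\mathcal{C}$-order (satisfies the Conrad property) if for all $f \succ id$, $g \succ id$ there exists $n \in \mathbb{N}$ such that $fg^n \succ g$. Dynamical realization: let $\preceq$ be a left-invariant total order on a countable group $\Gamma$ with numbering $(g_i)_{i\ge0}$ of its elements (without repetition). Define $t:\Gamma\to\mathbb{R}$ inductively: $t(g_0)=0$; given $t(g_0),\ldots,t(g_i)$, if $g_{i+1}$ is bigger (resp. smaller) than all of $g_0,\ldots,g_i$, put $t(g_{i+1}) = \max\{t(g_0),\ldots,t(g_i)\}+1$ (resp. $\min\{t(g_0),\ldots,t(g_i)\}-1$); if $g_m \prec g_{i+1}\prec g_n$ with $m,n\le i$ and no $g_j$, $0\le j\le i$, lies strictly between $g_m$ and $g_n$, put $t(g_{i+1}) = (t(g_m)+t(g_n))/2$. The group $\Gamma$ acts on $t(\Gamma)$ by $g(t(g_i)) = t(gg_i)$; this action extends continuously to the closure of $t(\Gamma)$ and then to $\mathbb{R}$ by extending affinely on each complementary interval of the closure (the trivial group acts trivially). The resulting (faithful) action by orientation-preserving homeomorphisms of $\mathbb{R}$ is the dynamical realization. Two orientation-preserving homeomorphisms of $\mathbb{R}$ are crossed on an interval $]a,b[$ if one of them fixes $a$ and $b$ and no other point in $[a,b]$,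 while the other one sends $a$ or $b$ into $]a,b[$. The cases $a=-\infty$ or $b=+\infty$ are allowed ($\pm\infty$ being regarded as fixed by every homeomorphism). A group is without crossed elements if no two of its elements are crossed on any interval. *)

theory Defs
  imports "HOL-Analysis.Analysis" "HOL-Algebra.Group"
begin

definition strictly :: "('a \<times> 'a) set \<Rightarrow> 'a \<Rightarrow> 'a \<Rightarrow> bool" where
  "strictly r x y \<longleftrightarrow> (x, y) \<in> r \<and> x \<noteq> y"

definition left_invariant_order :: "('a, 'b) monoid_scheme \<Rightarrow> ('a \<times> 'a) set \<Rightarrow> bool" where
  "left_invariant_order G r \<longleftrightarrow> linear_order_on (carrier G) r \<and>
     (\<forall>f\<in>carrier G. \<forall>g\<in>carrier G. \<forall>h\<in>carrier G. (g, h) \<in> r \<longrightarrow> (f \<otimes>\<^bsub>G\<^esub> g, f \<otimes>\<^bsub>G\<^esub> h) \<in> r)"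

(* Allowing n = 0 is harmless: if f is bigger than g and g is positive, then f g is bigger than g. *)
definition conrad_order :: "('a, 'b) monoid_scheme \<Rightarrow> ('a \<times> 'a) set \<Rightarrow> bool" where
  "conrad_order G r \<longleftrightarrow> left_invariant_order G r \<and>
     (\<forall>f\<in>carrier G. \<forall>g\<in>carrier G. strictly r \<one>\<^bsub>G\<^esub> f \<longrightarrow> strictly r \<one>\<^bsub>G\<^esub> g \<longrightarrow>
        (\<exists>n::nat. strictly r g (f \<otimes>\<^bsub>G\<^esub> g [^]\<^bsub>G\<^esub> n)))"

(* A numbering without repetition of a countable set, indexed by all naturals if A is infinite and
   by 0, ..., card A - 1 otherwise. The only finite group with a left-invariant total order is the
   trivial one. *)
definition numbering :: "'a set \<Rightarrow> (nat \<Rightarrow> 'a) \<Rightarrow> bool" where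
  "numbering A g \<longleftrightarrow> bij_betw g {i. finite A \<longrightarrow> i < card A} A"

(* The value assigned to x when the elements of the finite set S already have the values t. *)
definition next_value :: "('a \<times> 'a) set \<Rightarrow> 'a set \<Rightarrow> ('a \<Rightarrow> real) \<Rightarrow> 'a \<Rightarrow> real" where
  "next_value r S t x =
     (if \<forall>s\<in>S. strictly r s x then Max (t ` S) + 1
      else if \<forall>s\<in>S. strictly r x s then Min (t ` S) - 1
      else (THE v. \<exists>m\<in>S. \<exists>n\<in>S. strictly r m x \<and> strictly r x n \<and>
                     \<not> (\<exists>s\<in>S. strictly r m s \<and> strictly r s n) \<and> v = (t m + t n) / 2))"

(* t_stage r g i is correct on g 0, ..., g i and 0 elsewhere. *)
primrec t_stage :: "('a \<times> 'a) set \<Rightarrow> (nat \<Rightarrow> 'a) \<Rightarrow> nat \<Rightarrow> 'a \<Rightarrow> real" where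
  "t_stage r g 0 = (\<lambda>_. 0)"
| "t_stage r g (Suc i) =
     (t_stage r g i)(g (Suc i) := next_value r (g ` {..i}) (t_stage r g i) (g (Suc i)))"

definition t_map :: "('a \<times> 'a) set \<Rightarrow> (nat \<Rightarrow> 'a) \<Rightarrow> 'a \<Rightarrow> real" where
  "t_map r g x = t_stage r g (LEAST i. g i = x) x"

definition extend_closure :: "real set \<Rightarrow> (real \<Rightarrow> real) \<Rightarrow> real \<Rightarrow> real" where
  "extend_closure S \<phi> x = (if x \<in> S then \<phi> x else Lim (at x within S) \<phi>)"

(* Meant for closed C unbounded in both directions: outside C the value is given by affine
   interpolation between the endpoints a, b of the component of the complement containing x. *)
definition extend_affine :: "real set \<Rightarrow> (real \<Rightarrow> real) \<Rightarrow> real \<Rightarrow> real" where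
  "extend_affine C \<psi> x =
     (if x \<in> C then \<psi> x
      else let a = Sup {y \<in> C. y < x}; b = Inf {y \<in> C. x < y}
           in \<psi> a + (x - a) / (b - a) * (\<psi> b - \<psi> a))"

definition dynamical_action ::
  "('a, 'b) monoid_scheme \<Rightarrow> ('a \<times> 'a) set \<Rightarrow> (nat \<Rightarrow> 'a) \<Rightarrow> 'a \<Rightarrow> real \<Rightarrow> real" where
  "dynamical_action G r g h =
     (if carrier G = {\<one>\<^bsub>G\<^esub>} then id
      else let t = t_map r g; S = t ` carrier G
           in extend_affine (closure S)
                (extend_closure S (\<lambda>y. t (h \<otimes>\<^bsub>G\<^esub> inv_into (carrier G) t y))))"

definition dynamical_realization ::
  "('a, 'b) monoid_scheme \<Rightarrow> ('a \<times> 'a) set \<Rightarrow> (nat \<Rightarrow> 'a) \<Rightarrow> (real \<Rightarrow> real) set" where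
  "dynamical_realization G r g = dynamical_action G r g ` carrier G"

definition Homeo_plus :: "(real \<Rightarrow> real) monoid" where
  "Homeo_plus = \<lparr>carrier = {f. (\<exists>f'. homeomorphism UNIV UNIV f f') \<and> strict_mono f},
                 mult = (\<circ>), one = id\<rparr>"

lemma group_Homeo_plus: "group Homeo_plus"
proof (rule groupI)
  fix f g h
  assume f: "f \<in> carrier Homeo_plus"
  then obtain f' where f': "homeomorphism UNIV UNIV f f'" and mono: "strict_mono f"
    by (auto simp: Homeo_plus_def)
  have "strict_mono f'"
    using f' mono by (intro strict_monoI) (metis UNIV_I homeomorphism_def strict_mono_less)
  then have "f' \<in> carrier Homeo_plus"
    using f' by (auto simp: Homeo_plus_def intro: homeomorphism_symD)
  moreover have "f' \<circ> f = id"
    using f' by (auto simp: homeomorphism_def fun_eq_iff)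
  ultimately show "\<exists>k\<in>carrier Homeo_plus. k \<otimes>\<^bsub>Homeo_plus\<^esub> f = \<one>\<^bsub>Homeo_plus\<^esub>"
    by (auto simp: Homeo_plus_def)
  assume g: "g \<in> carrier Homeo_plus"
  then obtain g' where "homeomorphism UNIV UNIV g g'" "strict_mono g"
    by (auto simp: Homeo_plus_def)
  then show "f \<otimes>\<^bsub>Homeo_plus\<^esub> g \<in> carrier Homeo_plus"
    using f' mono by (auto simp: Homeo_plus_def strict_mono_def intro: homeomorphism_compose)
qed (auto simp: Homeo_plus_def strict_mono_def o_assoc id_def intro: homeomorphism_ident)

definition extend_ereal :: "(real \<Rightarrow> real) \<Rightarrow> ereal \<Rightarrow> ereal" where
  "extend_ereal f x = (case x of ereal y \<Rightarrow> ereal (f y) | PInfty \<Rightarrow> \<infinity> | MInfty \<Rightarrow> -\<infinity>)"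

definition crosses_on :: "(real \<Rightarrow> real) \<Rightarrow> (real \<Rightarrow> real) \<Rightarrow> ereal \<Rightarrow> ereal \<Rightarrow> bool" where
  "crosses_on f g a b \<longleftrightarrow> a < b \<and>
     (\<forall>x\<in>{a..b}. extend_ereal f x = x \<longleftrightarrow> x = a \<or> x = b) \<and>
     (extend_ereal g a \<in> {a<..<b} \<or> extend_ereal g b \<in> {a<..<b})"

definition crossed_on :: "(real \<Rightarrow> real) \<Rightarrow> (real \<Rightarrow> real) \<Rightarrow> ereal \<Rightarrow> ereal \<Rightarrow> bool" where
  "crossed_on f g a b \<longleftrightarrow> crosses_on f g a b \<or> crosses_on g f a b"

definition without_crossed_elements :: "(real \<Rightarrow> real) set \<Rightarrow> bool" where
  "without_crossed_elements H \<longleftrightarrow> (\<forall>f\<in>H. \<forall>g\<in>H. \<forall>a b. \<not> crossed_on f g a b)"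

end

(* The values of t turn left multiplication into order automorphisms of S = t(\<Gamma>). Since the
   construction of t inserts midpoints, every gap of the closure of S has both endpoints in S, and
   this makes an order automorphism of S extend to exactly one increasing map that is affine on the
   gaps; uniqueness gives the composition law, hence a group of homeomorphisms.

   On an orbit point s the Conrad property reads: if F s > s and G s > s, then F (G^n s) > G s for
   some n. So there is no c >= s with G c <= c and F c <= G s. Let f have no fixed point inside
   ]a,b[. This interval meets S, as otherwise f would preserve a gap and fix its endpoints, although
   the action on S is free. If g a lies in ]a,b[ and f contracts towards a, take c > g a, s < g a,
   G = g f^k and F = g f^N with N much larger than k. If g b lies in ]a,b[ and f pushes towards b,
   take c = b, s < f^-1 (g b), F = f^-1 g f^m and G = g f^k. Both choices give a contradiction. *)

theory Submission
  imports Defs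
begin

section \<open>Extending order automorphisms of a subset of the line\<close>

text \<open>The endpoints are required in \<open>S\<close> itself, not just in its closure, so that
  an automorphism of \<open>S\<close> can transport a gap.\<close>

definition is_gap :: "real set \<Rightarrow> real \<Rightarrow> real \<Rightarrow> bool" where
  "is_gap S a b \<longleftrightarrow> a \<in> S \<and> b \<in> S \<and> a < b \<and> {a<..<b} \<inter> S = {}"

definition affine_on_gaps :: "real set \<Rightarrow> (real \<Rightarrow> real) \<Rightarrow> bool" where
  "affine_on_gaps S F \<longleftrightarrow>
     (\<forall>a b x. is_gap S a b \<and> a < x \<and> x < b \<longrightarrow>
        F x = F a + (x - a) / (b - a) * (F b - F a))"

text \<open>The last assumption reflects the midpoint rule. If a complementary interval of the
  closure ended at a mere limit point of \<open>S\<close>, an automorphism of \<open>S\<close> could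
  open a jump there.\<close>

locale gapped =
  fixes S :: "real set"
  assumes unbounded_below: "\<exists>s\<in>S. s < x"
    and unbounded_above: "\<exists>s\<in>S. x < s"
    and gap_exists: "x \<notin> closure S \<Longrightarrow> \<exists>a b. is_gap S a b \<and> a < x \<and> x < b"
begin

lemma gap_not_closure:
  assumes "is_gap S a b" "a < x" "x < b"
  shows "x \<notin> closure S"
proof -
  have "{a<..<b} \<inter> closure S = {}"
    using assms(1) open_Int_closure_eq_empty[of "{a<..<b}" S] by (auto simp: is_gap_def)
  with assms show ?thesis by auto
qed

lemma gap_le:
  assumes "is_gap S a b" "a < x" "x < b" "s \<in> S"
  shows "s < x \<Longrightarrow> s \<le> a" "x < s \<Longrightarrow> b \<le> s"
proof -
  have "\<not> (a < s \<and> s < b)" using assms by (auto simp: is_gap_def disjoint_iff)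
  then show "s < x \<Longrightarrow> s \<le> a" "x < s \<Longrightarrow> b \<le> s" using assms(2,3) by linarith+
qed

lemma gap_unique:
  assumes "is_gap S a b" "a < x" "x < b" "is_gap S c d" "c < x" "x < d"
  shows "c = a" "d = b"
  using gap_le[OF assms(1-3)] gap_le[OF assms(4-6)] assms unfolding is_gap_def
  by (meson order_antisym)+

text \<open>The midpoint of the interval lies in a gap, and the endpoints of that gap, being in
  \<open>S\<close>, cannot fall strictly inside the interval.\<close>

lemma interval_in_gap:
  assumes "x < y" "{x<..<y} \<inter> S = {}"
  obtains a b where "is_gap S a b" "a \<le> x" "y \<le> b"
proof -
  have "{x<..<y} \<inter> closure S = {}"
    using assms open_Int_closure_eq_empty[of "{x<..<y}" S] by auto
  moreover have "(x + y) / 2 \<in> {x<..<y}"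
    using assms by auto
  ultimately have "(x + y) / 2 \<notin> closure S" by blast
  then obtain a b where ab: "is_gap S a b" "a < (x + y) / 2" "(x + y) / 2 < b"
    using gap_exists by blast
  then have "a \<in> S" "b \<in> S" by (auto simp: is_gap_def)
  then have "a \<le> x" "y \<le> b"
    using ab assms by (force simp: not_le disjoint_iff)+
  with ab(1) show thesis by (rule that)
qed

end

section \<open>The increasing extension of one order automorphism\<close>

locale gapped_automorphism = gapped +
  fixes \<phi> :: "real \<Rightarrow> real"
  assumes image: "\<phi> ` S = S"
    and strict_mono: "strict_mono_on S \<phi>"
begin

text \<open>The recipe of \<open>dynamical_action\<close>, with an arbitrary automorphism of
  \<open>S\<close> in place of left multiplication.\<close>

definition ext :: "real \<Rightarrow> real" where
  "ext = extend_affine (closure S) (extend_closure S \<phi>)"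

lemma less_iff: "s \<in> S \<Longrightarrow> s' \<in> S \<Longrightarrow> \<phi> s < \<phi> s' \<longleftrightarrow> s < s'"
  using strict_mono by (metis linorder_less_linear order_less_asym strict_mono_onD)

lemma in_S: "s \<in> S \<Longrightarrow> \<phi> s \<in> S"
  using image by blast

lemma gap_image:
  assumes "is_gap S a b"
  shows "is_gap S (\<phi> a) (\<phi> b)"
proof -
  have "y \<notin> S" if "\<phi> a < y" "y < \<phi> b" for y
  proof
    assume "y \<in> S"
    then obtain s where "s \<in> S" "y = \<phi> s" using image by blast
    then show False
      using that assms less_iff unfolding is_gap_def by force
  qed
  then show ?thesis using assms less_iff in_S by (auto simp: is_gap_def)
qed

lemma gap_preimage:
  assumes "is_gap S a b"
  obtains a' b' where "is_gap S a' b'" "a = \<phi> a'" "b = \<phi> b'"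
proof -
  obtain a' b' where ab: "a' \<in> S" "b' \<in> S" "a = \<phi> a'" "b = \<phi> b'"
    using assms image unfolding is_gap_def by (metis imageE)
  moreover have "s \<notin> S" if "a' < s" "s < b'" for s
  proof
    assume "s \<in> S"
    then have "\<phi> s \<in> {a<..<b} \<inter> S" using ab that less_iff in_S by simp
    with assms show False by (auto simp: is_gap_def)
  qed
  then have "is_gap S a' b'"
    using assms ab less_iff unfolding is_gap_def by auto
  ultimately show thesis using that by blast
qed

text \<open>Room between \<open>u\<close> and \<open>v\<close> would contain a gap, which is the image of a gap around \<open>x\<close>.\<close>

lemma cut_unique:
  assumes x: "x \<in> closure S" "x \<notin> S"
    and u: "\<And>s. s \<in> S \<Longrightarrow> s < x \<Longrightarrow> \<phi> s \<le> u" and v: "\<And>s. s \<in> S \<Longrightarrow> x < s \<Longrightarrow> v \<le> \<phi> s"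
  shows "v \<le> u"
proof (rule ccontr)
  assume "\<not> v \<le> u"
  moreover have "{u<..<v} \<inter> S = {}"
  proof -
    have False if y: "y \<in> S" "u < y" "y < v" for y
    proof -
      obtain s where "s \<in> S" "y = \<phi> s" using y(1) image by blast
      then show False using y u[of s] v[of s] x by (cases s x rule: linorder_cases) auto
    qed
    then show ?thesis by auto
  qed
  ultimately obtain a b where "is_gap S a b" and le: "a \<le> u" "v \<le> b"
    using interval_in_gap by (metis not_le)
  then obtain a' b' where ab: "is_gap S a' b'" "a = \<phi> a'" "b = \<phi> b'"
    using gap_preimage by blast
  then have "a' \<in> S" "b' \<in> S" by (auto simp: is_gap_def)
  \<comment> \<open>If \<open>x < a'\<close>, then \<open>v \<le> \<phi> a' = a \<le> u\<close>; if
    \<open>b' < x\<close>, then \<open>v \<le> b = \<phi> b' \<le> u\<close>.\<close>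
  moreover have "\<not> x < a'" "\<not> b' < x"
    using calculation u v le ab \<open>\<not> v \<le> u\<close> less_iff by force+
  ultimately have "a' < x" "x < b'"
    using x by (metis linorder_neqE)+
  then show False using gap_not_closure ab(1) x by blast
qed

lemma ext_eq: "s \<in> S \<Longrightarrow> ext s = \<phi> s"
  using closure_subset[of S] by (auto simp: ext_def extend_affine_def extend_closure_def)

lemma ext_gap:
  assumes "is_gap S a b" "a < x" "x < b"
  shows "ext x = \<phi> a + (x - a) / (b - a) * (\<phi> b - \<phi> a)"
proof -
  note no = gap_not_closure[OF assms(1)]
  have S: "a \<in> S" "b \<in> S" and cl: "a \<in> closure S" "b \<in> closure S"
    using assms closure_subset[of S] by (auto simp: is_gap_def)
  have "Sup {y \<in> closure S. y < x} = a"
  proof (intro cSup_eq_maximum)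
    show "y \<le> a" if "y \<in> {y \<in> closure S. y < x}" for y
      using that no[of y] assms(3) by (cases "a < y") auto
  qed (use cl assms(2) in auto)
  moreover have "Inf {y \<in> closure S. x < y} = b"
  proof (intro cInf_eq_minimum)
    show "b \<le> y" if "y \<in> {y \<in> closure S. x < y}" for y
      using that no[of y] assms(2) by (cases "y < b") auto
  qed (use cl assms(3) in auto)
  moreover have "x \<notin> closure S" using no assms by blast
  ultimately show ?thesis
    using S cl by (simp add: ext_def extend_affine_def extend_closure_def)
qed

text \<open>The left and right limits of \<open>\<phi>\<close> along \<open>S\<close> at such an
  \<open>x\<close> are controlled by \<open>Sup A\<close> and \<open>Inf B\<close>. By
  \<open>cut_unique\<close> these agree, so the \<open>Lim\<close> in \<open>extend_closure\<close>
  exists and is their common value.\<close>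

lemma ext_cut:
  assumes x: "x \<in> closure S" "x \<notin> S" and s: "s \<in> S"
  shows "s < x \<Longrightarrow> \<phi> s < ext x" "x < s \<Longrightarrow> ext x < \<phi> s"
proof -
  define A where "A = \<phi> ` {s\<in>S. s < x}"
  define B where "B = \<phi> ` {s\<in>S. x < s}"
  have ne: "A \<noteq> {}" "B \<noteq> {}"
    using unbounded_below unbounded_above by (auto simp: A_def B_def)
  have AB: "p \<le> q" if "p \<in> A" "q \<in> B" for p q
    using that less_iff by (force simp: A_def B_def)
  have bdd: "bdd_above A" "bdd_below B"
    using ne AB unfolding bdd_above_def bdd_below_def by blast+
  define u where "u = Sup A"
  have uA: "p \<le> u" if "p \<in> A" for p
    unfolding u_def using that bdd by (intro cSup_upper)
  have uB: "u \<le> q" if "q \<in> B" for q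
    unfolding u_def using that ne AB by (intro cSup_least) auto
  have vu: "Inf B \<le> u"
  proof (rule cut_unique[OF x])
    show "\<phi> s \<le> u" if "s \<in> S" "s < x" for s using that uA by (simp add: A_def)
    show "Inf B \<le> \<phi> s" if "s \<in> S" "x < s" for s
      using that bdd by (intro cInf_lower) (auto simp: B_def)
  qed
  have lim: "(\<phi> \<longlongrightarrow> u) (at x within S)"
  proof (rule order_tendstoI)
    fix c assume "c < u"
    then obtain s where s: "s \<in> S" "s < x" "c < \<phi> s"
      using less_cSup_iff[OF ne(1) bdd(1)] by (auto simp: u_def A_def)
    have "\<forall>\<^sub>F y in at x within S. s < y"
      using s(2) by (auto intro: order_tendstoD[OF tendsto_ident_at])
    moreover have "\<forall>\<^sub>F y in at x within S. y \<in> S" by (simp add: eventually_at_filter)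
    ultimately show "\<forall>\<^sub>F y in at x within S. c < \<phi> y"
      by eventually_elim (use s less_iff in force)
  next
    fix c assume "u < c"
    then obtain s where s: "s \<in> S" "x < s" "\<phi> s < c"
      using cInf_less_iff[OF ne(2) bdd(2), of c] vu by (auto simp: B_def)
    have "\<forall>\<^sub>F y in at x within S. y < s"
      using s(2) by (auto intro: order_tendstoD[OF tendsto_ident_at])
    moreover have "\<forall>\<^sub>F y in at x within S. y \<in> S" by (simp add: eventually_at_filter)
    ultimately show "\<forall>\<^sub>F y in at x within S. \<phi> y < c"
      by eventually_elim (use s less_iff in force)
  qed
  have "at x within S \<noteq> bot"
    using x by (auto simp: closure_def trivial_limit_within)
  then have ext: "ext x = u"
    using x lim by (simp add: ext_def extend_affine_def extend_closure_def tendsto_Lim)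
  {
    assume "s < x"
    \<comment> \<open>Strictness needs one more point of \<open>S\<close> between \<open>s\<close>
      and \<open>x\<close>. Without it \<open>x\<close> would lie inside a gap, hence outside the
      closure.\<close>
    then obtain s' where "s' \<in> S" "s < s'" "s' < x"
    proof -
      have "\<not> {s<..<x} \<inter> S = {}"
      proof
        assume "{s<..<x} \<inter> S = {}"
        then obtain a b where ab: "is_gap S a b" "a \<le> s" "x \<le> b"
          using interval_in_gap \<open>s < x\<close> by blast
        then have "x < b" using x by (auto simp: is_gap_def order_le_less)
        then show False using gap_not_closure[OF ab(1), of x] ab \<open>s < x\<close> x by auto
      qed
      with that show thesis by auto
    qed
    then have "\<phi> s < \<phi> s'" "\<phi> s' \<le> u" using s less_iff uA by (auto simp: A_def)
    then show "\<phi> s < ext x" using ext by simp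
  }
  {
    assume "x < s"
    then obtain s' where "s' \<in> S" "s' < s" "x < s'"
    proof -
      have "\<not> {x<..<s} \<inter> S = {}"
      proof
        assume "{x<..<s} \<inter> S = {}"
        then obtain a b where ab: "is_gap S a b" "a \<le> x" "s \<le> b"
          using interval_in_gap \<open>x < s\<close> by blast
        then have "a < x" using x by (auto simp: is_gap_def order_le_less)
        then show False using gap_not_closure[OF ab(1), of x] ab \<open>x < s\<close> x by auto
      qed
      with that show thesis by auto
    qed
    then have "\<phi> s' < \<phi> s" "u \<le> \<phi> s'" using s less_iff uB by (auto simp: B_def)
    then show "ext x < \<phi> s" using ext by simp
  }
qed

text \<open>The new case is a point in a gap: the affine formula has a weight \<open>l\<close>
  strictly between 0 and 1, so the value stays strictly between the images of the endpoints.\<close>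

lemma ext_separates:
  assumes s: "s \<in> S"
  shows "s < x \<Longrightarrow> \<phi> s < ext x" "x < s \<Longrightarrow> ext x < \<phi> s"
proof -
  consider "x \<in> S" | "x \<in> closure S" "x \<notin> S" | "x \<notin> closure S" by blast
  then have "(s < x \<longrightarrow> \<phi> s < ext x) \<and> (x < s \<longrightarrow> ext x < \<phi> s)"
  proof cases
    case 1
    then show ?thesis using s less_iff ext_eq by auto
  next
    case 2
    then show ?thesis using s ext_cut by blast
  next
    case 3
    then obtain a b where ab: "is_gap S a b" "a < x" "x < b" using gap_exists by blast
    then have abS: "a \<in> S" "b \<in> S" and "\<phi> a < \<phi> b" using less_iff by (auto simp: is_gap_def)
    define l where "l = (x - a) / (b - a)"
    have "0 < l" "l < 1" using ab by (auto simp: l_def)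
    moreover have "ext x = \<phi> a + l * (\<phi> b - \<phi> a)" using ext_gap[OF ab] by (simp add: l_def)
    moreover have "0 < l * (\<phi> b - \<phi> a)" "l * (\<phi> b - \<phi> a) < 1 * (\<phi> b - \<phi> a)"
      using \<open>0 < l\<close> \<open>l < 1\<close> \<open>\<phi> a < \<phi> b\<close> by (auto intro: mult_strict_right_mono)
    ultimately have "\<phi> a < ext x" "ext x < \<phi> b" by simp_all
    moreover have "\<phi> s \<le> \<phi> a" if "s < x"
      using gap_le(1)[OF ab s that] less_iff[OF abS(1) s] by (simp add: not_less[symmetric])
    moreover have "\<phi> b \<le> \<phi> s" if "x < s"
      using gap_le(2)[OF ab s that] less_iff[OF s abS(2)] by (simp add: not_less[symmetric])
    ultimately show ?thesis by force
  qed
  then show "s < x \<Longrightarrow> \<phi> s < ext x" "x < s \<Longrightarrow> ext x < \<phi> s" by blast+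
qed

text \<open>Either a point of \<open>S\<close> in the closed interval from \<open>x\<close> to
  \<open>y\<close> separates the images, or both points lie in one gap, where \<open>ext\<close> is
  affine with positive slope.\<close>

lemma strict_mono_ext: "strict_mono ext"
proof (rule strict_monoI)
  fix x y :: real assume "x < y"
  show "ext x < ext y"
  proof (cases "\<exists>s\<in>S. x \<le> s \<and> s \<le> y")
    case True
    then obtain s where s: "s \<in> S" "x \<le> s" "s \<le> y" by blast
    then have "ext x \<le> \<phi> s" "\<phi> s \<le> ext y"
      using ext_separates[of s] ext_eq[of s] by (metis order_le_less)+
    moreover have "ext x < \<phi> s \<or> \<phi> s < ext y"
      using ext_separates[of s] s \<open>x < y\<close> by (metis order_le_less order_less_le_trans)
    ultimately show ?thesis by auto
  next
    case False
    then have "{x<..<y} \<inter> S = {}" by force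
    then obtain a b where ab: "is_gap S a b" "a \<le> x" "y \<le> b"
      using interval_in_gap \<open>x < y\<close> by blast
    then have "a \<in> S" "b \<in> S" "a < b" by (auto simp: is_gap_def)
    then have lt: "a < x" "y < b" and "0 < (\<phi> b - \<phi> a) / (b - a)"
      using False ab \<open>x < y\<close> less_iff by (force simp: order_le_less)+
    have "ext y - ext x = (y - x) * ((\<phi> b - \<phi> a) / (b - a))"
      using ext_gap[OF ab(1), of x] ext_gap[OF ab(1), of y] lt \<open>x < y\<close> \<open>a < b\<close>
      by (simp add: field_simps)
    also have "\<dots> > 0"
      using \<open>x < y\<close> \<open>0 < (\<phi> b - \<phi> a) / (b - a)\<close> by (intro mult_pos_pos) auto
    finally show ?thesis by simp
  qed
qed

text \<open>At a cut, monotonicity confines both \<open>F x\<close> and \<open>ext x\<close> to the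
  same slot between values of \<open>\<phi>\<close>, and \<open>cut_unique\<close> leaves no room in
  it. This lemma is the source of the composition law.\<close>

lemma ext_unique:
  assumes mono: "strict_mono F" and F: "\<And>s. s \<in> S \<Longrightarrow> F s = \<phi> s" and aff: "affine_on_gaps S F"
  shows "F = ext"
proof
  fix x
  consider "x \<in> S" | "x \<in> closure S" "x \<notin> S" | "x \<notin> closure S" by blast
  then show "F x = ext x"
  proof cases
    case 1
    then show ?thesis using F ext_eq by simp
  next
    case 2
    have *: "s \<in> S \<Longrightarrow> s < x \<Longrightarrow> \<phi> s < F x" "s \<in> S \<Longrightarrow> x < s \<Longrightarrow> F x < \<phi> s" for s
      using mono F by (metis strict_monoD)+
    show ?thesis
    proof (rule order_antisym)
      show "F x \<le> ext x"
        using cut_unique[OF 2, of "ext x" "F x"] * ext_separates by (meson order_less_imp_le)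
      show "ext x \<le> F x"
        using cut_unique[OF 2, of "F x" "ext x"] * ext_separates by (meson order_less_imp_le)
    qed
  next
    case 3
    then obtain a b where ab: "is_gap S a b" "a < x" "x < b" using gap_exists by blast
    then have "a \<in> S" "b \<in> S" by (auto simp: is_gap_def)
    then show ?thesis
      using ab aff F ext_gap[OF ab] unfolding affine_on_gaps_def by metis
  qed
qed

lemma ext_id:
  assumes "\<And>s. s \<in> S \<Longrightarrow> \<phi> s = s"
  shows "ext = id"
proof -
  have "affine_on_gaps S id" by (auto simp: affine_on_gaps_def is_gap_def)
  then show ?thesis using assms ext_unique[of id] by (simp add: strict_mono_def)
qed

text \<open>If \<open>I\<close> missed \<open>S\<close>, then \<open>z\<close> and
  \<open>ext z\<close> would lie in a single gap. The image of that gap also contains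
  \<open>ext z\<close>, so the two gaps coincide and \<open>\<phi>\<close> fixes the left
  endpoint.\<close>

lemma moved_interval_meets:
  assumes I: "is_interval I" "z \<in> I" "ext z \<in> I" and moved: "ext z \<noteq> z"
    and free: "\<And>s. s \<in> S \<Longrightarrow> \<phi> s \<noteq> s"
  shows "I \<inter> S \<noteq> {}"
proof
  assume disj: "I \<inter> S = {}"
  have seg: "{min z (ext z)<..<max z (ext z)} \<inter> S = {}"
  proof -
    have "min z (ext z) \<in> I" "max z (ext z) \<in> I"
      using I by (auto simp: min_def max_def)
    then have "{min z (ext z)<..<max z (ext z)} \<subseteq> I"
      using I(1) unfolding is_interval_1 by (meson greaterThanLessThan_iff order_less_imp_le subsetI)
    with disj show ?thesis by blast
  qed
  have "min z (ext z) < max z (ext z)" using moved by (simp add: min_def max_def)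
  then obtain a b where ab: "is_gap S a b" "a \<le> min z (ext z)" "max z (ext z) \<le> b"
    using interval_in_gap[OF _ seg] by blast
  have S: "a \<in> S" "b \<in> S" using ab by (auto simp: is_gap_def)
  then have "z \<noteq> a" "z \<noteq> b" "ext z \<noteq> a" "ext z \<noteq> b" using disj I by blast+
  then have *: "a < ext z" "ext z < b" "a < z" "z < b" using ab by auto
  have "\<phi> a < ext z" "ext z < \<phi> b" using ext_separates S * by auto
  then have "\<phi> a = a" using gap_unique(1)[OF ab(1) *(1,2) gap_image[OF ab(1)]] by blast
  then show False using free S by blast
qed

end

text \<open>The inner map carries each gap affinely onto a gap and preserves relative position in
  it. Hence the composite is affine on gaps, and \<open>ext_unique\<close> identifies it.\<close>

lemma ext_comp:
  assumes "gapped_automorphism S \<phi>" "gapped_automorphism S \<psi>" "gapped_automorphism S \<theta>"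
    and comp: "\<And>s. s \<in> S \<Longrightarrow> \<theta> s = \<phi> (\<psi> s)"
  shows "gapped_automorphism.ext S \<theta> =
    gapped_automorphism.ext S \<phi> \<circ> gapped_automorphism.ext S \<psi>"
proof -
  interpret A: gapped_automorphism S \<phi> by fact
  interpret B: gapped_automorphism S \<psi> by fact
  interpret C: gapped_automorphism S \<theta> by fact
  have "affine_on_gaps S (A.ext \<circ> B.ext)"
    unfolding affine_on_gaps_def
  proof (intro allI impI, elim conjE)
    fix a b x assume ab: "is_gap S a b" "a < x" "x < b"
    then have S: "a \<in> S" "b \<in> S" "a < b" by (auto simp: is_gap_def)
    then have "\<psi> a < \<psi> b" using B.less_iff by blast
    have x: "\<psi> a < B.ext x" "B.ext x < \<psi> b" using ab S B.ext_separates by auto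
    have "A.ext (B.ext x) =
        \<phi> (\<psi> a) + (B.ext x - \<psi> a) / (\<psi> b - \<psi> a) * (\<phi> (\<psi> b) - \<phi> (\<psi> a))"
      using A.ext_gap[OF B.gap_image[OF ab(1)] x] .
    moreover have "(B.ext x - \<psi> a) / (\<psi> b - \<psi> a) = (x - a) / (b - a)"
      using \<open>\<psi> a < \<psi> b\<close> by (simp add: B.ext_gap[OF ab])
    ultimately show "(A.ext \<circ> B.ext) x = (A.ext \<circ> B.ext) a +
        (x - a) / (b - a) * ((A.ext \<circ> B.ext) b - (A.ext \<circ> B.ext) a)"
      using S by (simp add: A.ext_eq B.ext_eq B.in_S)
  qed
  then show ?thesis
    using C.ext_unique[of "A.ext \<circ> B.ext"] A.strict_mono_ext B.strict_mono_ext comp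
    by (auto simp: strict_mono_def A.ext_eq B.ext_eq B.in_S)
qed

section \<open>The values of the dynamical realization\<close>

locale strict_linear_order =
  fixes A :: "'a set" and r :: "('a \<times> 'a) set"
  assumes order: "linear_order_on A r"
begin

abbreviation lt (infix "\<sqsubset>" 50) where "x \<sqsubset> y \<equiv> strictly r x y"

lemma lt_in: "x \<sqsubset> y \<Longrightarrow> x \<in> A \<and> y \<in> A"
  using order by (auto simp: order_on_defs refl_on_def strictly_def)

lemma lt_irrefl: "\<not> x \<sqsubset> x"
  by (simp add: strictly_def)

lemma lt_trans: "x \<sqsubset> y \<Longrightarrow> y \<sqsubset> z \<Longrightarrow> x \<sqsubset> z"
  using order unfolding strictly_def order_on_defs by (meson antisymD transD)

lemma lt_asym: "x \<sqsubset> y \<Longrightarrow> \<not> y \<sqsubset> x"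
  using lt_trans lt_irrefl by blast

lemma lt_linear: "x \<in> A \<Longrightarrow> y \<in> A \<Longrightarrow> x \<noteq> y \<Longrightarrow> x \<sqsubset> y \<or> y \<sqsubset> x"
  using order unfolding strictly_def order_on_defs total_on_def by blast

lemma finite_has_greatest:
  assumes "finite B" "B \<noteq> {}" "B \<subseteq> A"
  shows "\<exists>m\<in>B. \<forall>b\<in>B. b = m \<or> b \<sqsubset> m"
  using assms
proof (induction B rule: finite_ne_induct)
  case (insert x B)
  then obtain m where m: "m \<in> B" "\<forall>b\<in>B. b = m \<or> b \<sqsubset> m" by auto
  consider "x = m \<or> x \<sqsubset> m" | "m \<sqsubset> x" using lt_linear[of x m] insert.prems m(1) by blast
  then show ?case
  proof cases
    case 2
    then have "\<forall>b\<in>B. b \<sqsubset> x" using m(2) lt_trans by metis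
    then show ?thesis by blast
  qed (use m in blast)
qed simp

lemma finite_has_least:
  assumes "finite B" "B \<noteq> {}" "B \<subseteq> A"
  shows "\<exists>m\<in>B. \<forall>b\<in>B. b = m \<or> m \<sqsubset> b"
  using assms
proof (induction B rule: finite_ne_induct)
  case (insert x B)
  then obtain m where m: "m \<in> B" "\<forall>b\<in>B. b = m \<or> m \<sqsubset> b" by auto
  consider "x = m \<or> m \<sqsubset> x" | "x \<sqsubset> m" using lt_linear[of x m] insert.prems m(1) by blast
  then show ?case
  proof cases
    case 2
    then have "\<forall>b\<in>B. x \<sqsubset> b" using m(2) lt_trans by metis
    then show ?thesis by blast
  qed (use m in blast)
qed simp

lemma next_value_top:
  "\<forall>s\<in>B. s \<sqsubset> x \<Longrightarrow> next_value r B t x = Max (t ` B) + 1"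
  by (simp add: next_value_def)

lemma next_value_bot:
  assumes "\<forall>s\<in>B. x \<sqsubset> s" "B \<noteq> {}"
  shows "next_value r B t x = Min (t ` B) - 1"
  using assms lt_asym unfolding next_value_def by auto

text \<open>By linearity only one pair of consecutive elements of \<open>B\<close> encloses
  \<open>x\<close>, so the definite description in \<open>next_value\<close> denotes.\<close>

lemma next_value_between:
  assumes B: "B \<subseteq> A" and mn: "m \<in> B" "n \<in> B" "m \<sqsubset> x" "x \<sqsubset> n" "\<not> (\<exists>s\<in>B. m \<sqsubset> s \<and> s \<sqsubset> n)"
  shows "next_value r B t x = (t m + t n) / 2"
proof -
  have "m' = m \<and> n' = n"
    if "m' \<in> B" "n' \<in> B" "m' \<sqsubset> x" "x \<sqsubset> n'" "\<not> (\<exists>s\<in>B. m' \<sqsubset> s \<and> s \<sqsubset> n')" for m' n'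
    using that mn B lt_linear[of m m'] lt_linear[of n n'] lt_trans by blast
  then have "(THE v. \<exists>m\<in>B. \<exists>n\<in>B. m \<sqsubset> x \<and> x \<sqsubset> n \<and> \<not> (\<exists>s\<in>B. m \<sqsubset> s \<and> s \<sqsubset> n) \<and>
      v = (t m + t n) / 2) = (t m + t n) / 2"
    using mn by (intro the_equality) blast+
  moreover have "\<not> (\<forall>s\<in>B. s \<sqsubset> x)" "\<not> (\<forall>s\<in>B. x \<sqsubset> s)" using mn lt_asym by blast+
  ultimately show ?thesis unfolding next_value_def by (simp only: if_False)
qed

text \<open>Allows the stage function in the recursion to be replaced by the final map
  \<open>t\<close>, as done in \<open>t_Suc\<close>.\<close>

lemma next_value_cong:
  assumes "\<And>s. s \<in> B \<Longrightarrow> t s = t' s"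
  shows "next_value r B t x = next_value r B t' x"
proof -
  have "t ` B = t' ` B" using assms by auto
  moreover have "(\<lambda>v. \<exists>m\<in>B. \<exists>n\<in>B. m \<sqsubset> x \<and> x \<sqsubset> n \<and> \<not> (\<exists>s\<in>B. m \<sqsubset> s \<and> s \<sqsubset> n) \<and> v = (t m + t n) / 2) =
     (\<lambda>v. \<exists>m\<in>B. \<exists>n\<in>B. m \<sqsubset> x \<and> x \<sqsubset> n \<and> \<not> (\<exists>s\<in>B. m \<sqsubset> s \<and> s \<sqsubset> n) \<and> v = (t' m + t' n) / 2)"
    using assms by (intro ext) (auto cong: bex_cong)
  ultimately show ?thesis unfolding next_value_def by presburger
qed

lemma neighbours:
  assumes "finite B" "B \<subseteq> A" "x \<in> A" "x \<notin> B" "s \<in> B" "s \<sqsubset> x" "s' \<in> B" "x \<sqsubset> s'"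
  obtains m n where "m \<in> B" "n \<in> B" "m \<sqsubset> x" "x \<sqsubset> n" "\<not> (\<exists>s\<in>B. m \<sqsubset> s \<and> s \<sqsubset> n)"
    "\<And>b. b \<in> B \<Longrightarrow> b = m \<or> b \<sqsubset> m \<or> b = n \<or> n \<sqsubset> b"
proof -
  obtain m where m: "m \<in> B" "m \<sqsubset> x" "\<forall>b\<in>B. b \<sqsubset> x \<longrightarrow> b = m \<or> b \<sqsubset> m"
    using finite_has_greatest[of "{b \<in> B. b \<sqsubset> x}"] assms by auto
  obtain n where n: "n \<in> B" "x \<sqsubset> n" "\<forall>b\<in>B. x \<sqsubset> b \<longrightarrow> b = n \<or> n \<sqsubset> b"
    using finite_has_least[of "{b \<in> B. x \<sqsubset> b}"] assms by auto
  have "b \<sqsubset> x \<or> x \<sqsubset> b" if "b \<in> B" for b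
    using that assms lt_linear[of b x] by blast
  then have *: "b = m \<or> b \<sqsubset> m \<or> b = n \<or> n \<sqsubset> b" if "b \<in> B" for b
    using m n that by blast
  have "\<not> (\<exists>s\<in>B. m \<sqsubset> s \<and> s \<sqsubset> n)" using * lt_irrefl lt_asym by metis
  then show thesis using that[OF m(1) n(1) m(2) n(2)] * by blast
qed

end

section \<open>Monotonicity, unboundedness and gaps of the values \<open>t\<close>\<close>

locale unbounded_numbered_order = strict_linear_order +
  fixes g :: "nat \<Rightarrow> 'a"
  assumes numbering: "bij_betw g UNIV A"
    and no_greatest: "x \<in> A \<Longrightarrow> \<exists>y. x \<sqsubset> y"
    and no_least: "x \<in> A \<Longrightarrow> \<exists>y. y \<sqsubset> x"
begin

abbreviation "t \<equiv> t_map r g"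

lemma g_in: "g i \<in> A"
  using numbering by (auto simp: bij_betw_def)

lemma g_eq_iff: "g i = g j \<longleftrightarrow> i = j"
  using numbering by (auto simp: bij_betw_def inj_def)

lemma g_surj: "x \<in> A \<Longrightarrow> \<exists>i. x = g i"
  using numbering by (auto simp: bij_betw_def)

lemma t_stage_eq: "j \<le> i \<Longrightarrow> t_stage r g i (g j) = t (g j)"
proof (induction i)
  case (Suc i)
  then show ?case
  proof (cases "j = Suc i")
    case True
    have "(LEAST i. g i = g j) = j" by (intro Least_equality) (auto simp: g_eq_iff)
    then show ?thesis using True by (simp add: t_map_def)
  qed (use Suc g_eq_iff in auto)
qed (simp add: t_map_def g_eq_iff)

lemma t_Suc: "t (g (Suc i)) = next_value r (g ` {..i}) t (g (Suc i))"
proof -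
  have "t (g (Suc i)) = next_value r (g ` {..i}) (t_stage r g i) (g (Suc i))"
    using t_stage_eq[of "Suc i" "Suc i"] by simp
  then show ?thesis
    using t_stage_eq by (auto intro: trans next_value_cong)
qed

lemma initial:
  "finite (g ` {..i})" "g ` {..i} \<noteq> {}" "g ` {..i} \<subseteq> A" "g (Suc i) \<notin> g ` {..i}"
  using g_in by (auto simp: g_eq_iff)

text \<open>Induction on the stage: the new value is beyond all old ones, or it is the midpoint of
  the values of its two neighbours, and every other old element lies beyond one of these.\<close>

lemma t_mono_initial: "x \<in> g ` {..i} \<Longrightarrow> y \<in> g ` {..i} \<Longrightarrow> x \<sqsubset> y \<Longrightarrow> t x < t y"
proof (induction i arbitrary: x y)
  case 0
  then show ?case using lt_irrefl by auto
next
  case (Suc i)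
  define B where "B = g ` {..i}"
  define z where "z = g (Suc i)"
  have B: "finite B" "B \<noteq> {}" "B \<subseteq> A" "z \<notin> B" and z: "z \<in> A"
    using initial g_in by (auto simp: B_def z_def)
  have tz: "t z = next_value r B t z" using t_Suc by (simp add: B_def z_def)
  have IH: "x \<in> B \<Longrightarrow> y \<in> B \<Longrightarrow> x \<sqsubset> y \<Longrightarrow> t x < t y" for x y
    using Suc.IH by (simp add: B_def)
  have "(b \<sqsubset> z \<longrightarrow> t b < t z) \<and> (z \<sqsubset> b \<longrightarrow> t z < t b)" if b: "b \<in> B" for b
  proof -
    consider "\<forall>s\<in>B. s \<sqsubset> z" | "\<forall>s\<in>B. z \<sqsubset> s" | s s' where "s \<in> B" "s \<sqsubset> z" "s' \<in> B" "z \<sqsubset> s'"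
      using lt_linear B z by blast
    then show ?thesis
    proof cases
      case 1
      then have "t z = Max (t ` B) + 1" using tz next_value_top by simp
      moreover have "t b \<le> Max (t ` B)" using B b by simp
      ultimately show ?thesis using 1 b lt_asym by force
    next
      case 2
      then have "t z = Min (t ` B) - 1" using tz next_value_bot B by simp
      moreover have "Min (t ` B) \<le> t b" using B b by simp
      ultimately show ?thesis using 2 b lt_asym by force
    next
      case (3 s s')
      obtain m n where mn: "m \<in> B" "n \<in> B" "m \<sqsubset> z" "z \<sqsubset> n" "\<not> (\<exists>s\<in>B. m \<sqsubset> s \<and> s \<sqsubset> n)"
        and *: "\<And>b. b \<in> B \<Longrightarrow> b = m \<or> b \<sqsubset> m \<or> b = n \<or> n \<sqsubset> b"
        using neighbours[OF B(1,3) z B(4) 3] by blast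
      have "t z = (t m + t n) / 2" using tz next_value_between[OF B(3) mn] by simp
      moreover have "t m < t n" using IH mn lt_trans by blast
      ultimately have "t m < t z" "t z < t n" by auto
      moreover have "b \<sqsubset> z \<Longrightarrow> t b \<le> t m" "z \<sqsubset> b \<Longrightarrow> t n \<le> t b"
        using *[OF b] IH[of b m] IH[of n b] mn b lt_trans lt_asym by (metis order_le_less)+
      ultimately show ?thesis by force
    qed
  qed
  moreover have "x \<in> insert z B" "y \<in> insert z B"
    using Suc.prems by (auto simp: B_def z_def atMost_Suc)
  ultimately show ?case using IH Suc.prems(3) lt_irrefl by blast
qed

lemma t_mono: "x \<sqsubset> y \<Longrightarrow> t x < t y"
proof -
  assume "x \<sqsubset> y"
  moreover then obtain i j where "x = g i" "y = g j" using lt_in g_surj by meson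
  ultimately show ?thesis
    using t_mono_initial[of x "max i j" y] by auto
qed

lemma t_less_iff: "x \<in> A \<Longrightarrow> y \<in> A \<Longrightarrow> t x < t y \<longleftrightarrow> x \<sqsubset> y"
  using t_mono lt_linear by (metis order_less_asym order_less_irrefl)

lemma inj_t: "inj_on t A"
  using t_mono lt_linear by (metis inj_onI order_less_irrefl)

text \<open>Among the elements above the greatest \<open>m\<close> of the first ones, take the one
  numbered first. It exceeds everything numbered before it, so its value is a maximum plus
  1.\<close>

lemma t_surpassed: "\<exists>j. t (g j) \<ge> t (g i) + 1"
proof -
  obtain m where m: "m \<in> g ` {..i}" "\<forall>b\<in>g ` {..i}. b = m \<or> b \<sqsubset> m"
    using finite_has_greatest initial by meson
  obtain k where k: "m \<sqsubset> g k" using no_greatest g_surj m lt_in initial(3) by (metis subsetD)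
  define j where "j = (LEAST j. m \<sqsubset> g j)"
  have j: "m \<sqsubset> g j" "\<And>l. l < j \<Longrightarrow> \<not> m \<sqsubset> g l"
    unfolding j_def using k LeastI not_less_Least by (metis (full_types))+
  have "\<not> j \<le> i"
  proof
    assume "j \<le> i"
    then have "g j = m \<or> g j \<sqsubset> m" using m by auto
    then show False using j(1) lt_asym lt_irrefl by blast
  qed
  then obtain j' where j': "j = Suc j'" "i \<le> j'" by (cases j) auto
  have "s \<sqsubset> g j" if s: "s \<in> g ` {..j'}" for s
  proof -
    obtain l where "s = g l" "l < j" using s j'(1) by auto
    then show ?thesis using j lt_linear[of m s] lt_trans lt_in g_in by metis
  qed
  then have "t (g j) = Max (t ` g ` {..j'}) + 1"
    using t_Suc[of j'] next_value_top j'(1) by simp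
  moreover have "t (g i) \<le> Max (t ` g ` {..j'})" using j'(2) by (intro Max_ge) auto
  ultimately show ?thesis by (intro exI[of _ j]) simp
qed

lemma t_undercut: "\<exists>j. t (g j) \<le> t (g i) - 1"
proof -
  obtain m where m: "m \<in> g ` {..i}" "\<forall>b\<in>g ` {..i}. b = m \<or> m \<sqsubset> b"
    using finite_has_least initial by meson
  obtain k where k: "g k \<sqsubset> m" using no_least g_surj m lt_in initial(3) by (metis subsetD)
  define j where "j = (LEAST j. g j \<sqsubset> m)"
  have j: "g j \<sqsubset> m" "\<And>l. l < j \<Longrightarrow> \<not> g l \<sqsubset> m"
    unfolding j_def using k LeastI not_less_Least by (metis (full_types))+
  have "\<not> j \<le> i"
  proof
    assume "j \<le> i"
    then have "g j = m \<or> m \<sqsubset> g j" using m by auto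
    then show False using j(1) lt_asym lt_irrefl by blast
  qed
  then obtain j' where j': "j = Suc j'" "i \<le> j'" by (cases j) auto
  have "g j \<sqsubset> s" if s: "s \<in> g ` {..j'}" for s
  proof -
    obtain l where "s = g l" "l < j" using s j'(1) by auto
    then show ?thesis using j lt_linear[of m s] lt_trans lt_in g_in by metis
  qed
  then have "t (g j) = Min (t ` g ` {..j'}) - 1"
    using t_Suc[of j'] next_value_bot initial(2) j'(1) by simp
  moreover have "Min (t ` g ` {..j'}) \<le> t (g i)" using j'(2) by (intro Min_le) auto
  ultimately show ?thesis by (intro exI[of _ j]) simp
qed

lemma t_unbounded_above: "\<exists>i. x < t (g i)"
proof -
  have "\<exists>i. real n \<le> t (g i) - t (g 0)" for n
  proof (induction n)
    case (Suc n)
    then obtain i where i: "real n \<le> t (g i) - t (g 0)" by blast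
    obtain j where "t (g i) + 1 \<le> t (g j)" using t_surpassed by blast
    then have "real (Suc n) \<le> t (g j) - t (g 0)" using i by simp
    then show ?case by blast
  qed auto
  moreover obtain n where "x - t (g 0) < real n" using reals_Archimedean2 by blast
  ultimately obtain i where "x - t (g 0) < t (g i) - t (g 0)" by (meson order_less_le_trans)
  then show ?thesis by auto
qed

lemma t_unbounded_below: "\<exists>i. t (g i) < x"
proof -
  have "\<exists>i. real n \<le> t (g 0) - t (g i)" for n
  proof (induction n)
    case (Suc n)
    then obtain i where i: "real n \<le> t (g 0) - t (g i)" by blast
    obtain j where "t (g j) \<le> t (g i) - 1" using t_undercut by blast
    then have "real (Suc n) \<le> t (g 0) - t (g j)" using i by simp
    then show ?case by blast
  qed auto
  moreover obtain n where "t (g 0) - x < real n" using reals_Archimedean2 by blast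
  ultimately obtain i where "t (g 0) - x < t (g 0) - t (g i)" by (meson order_less_le_trans)
  then show ?thesis by auto
qed

text \<open>Each new value inside a bracket of consecutive old values is its midpoint, so a point that
  never gets a permanent bracket is a limit of values.\<close>

lemma t_bracket:
  assumes x: "x \<notin> closure (t ` A)"
  shows "\<exists>l u. t (g l) < x \<and> x < t (g u) \<and> (\<forall>i. \<not> (t (g l) < t (g i) \<and> t (g i) < t (g u)))"
proof (rule ccontr)
  assume no: "\<not> ?thesis"
  have xS: "x \<noteq> t (g i)" for i
  proof -
    have "t (g i) \<in> closure (t ` A)" using closure_subset g_in by (rule subsetD[OF _ imageI])
    with x show ?thesis by blast
  qed
  obtain l0 where l0: "t (g l0) < x" using t_unbounded_below by blast
  obtain u0 where u0: "x < t (g u0)" using t_unbounded_above by blast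
  define D where "D = t (g u0) - t (g l0)"
  \<comment> \<open>By \<open>no\<close>, some value enters every bracket around \<open>x\<close>.
    The first to enter is its midpoint, so the half containing \<open>x\<close> is again a bracket
    of consecutive values.\<close>
  have step: "\<exists>k l u. l \<le> k \<and> u \<le> k \<and> t (g l) < x \<and> x < t (g u) \<and>
      (\<forall>i\<le>k. \<not> (t (g l) < t (g i) \<and> t (g i) < t (g u))) \<and> t (g u) - t (g l) \<le> d / 2"
    if H: "l \<le> k" "u \<le> k" "t (g l) < x" "x < t (g u)"
      "\<forall>i\<le>k. \<not> (t (g l) < t (g i) \<and> t (g i) < t (g u))" "t (g u) - t (g l) \<le> d" for k l u d
  proof -
    define P where "P = (\<lambda>i. t (g l) < t (g i) \<and> t (g i) < t (g u))"
    have "\<exists>i. P i" using no H(3,4) by (auto simp: P_def)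
    then obtain j where j: "P j" "\<And>i. i < j \<Longrightarrow> \<not> P i"
      using LeastI_ex[of P] not_less_Least[of _ P] by blast
    have "\<not> j \<le> k" using H(5) j(1) by (auto simp: P_def)
    then obtain j' where j': "j = Suc j'" "k \<le> j'" by (cases j) auto
    have mid: "t (g j) = (t (g l) + t (g u)) / 2"
      unfolding j'(1) t_Suc[of j']
    proof (rule next_value_between)
      show "g l \<sqsubset> g (Suc j')" "g (Suc j') \<sqsubset> g u"
        using j(1) t_less_iff g_in by (auto simp: P_def j'(1))
      show "\<not> (\<exists>s\<in>g ` {..j'}. g l \<sqsubset> s \<and> s \<sqsubset> g u)"
      proof
        assume "\<exists>s\<in>g ` {..j'}. g l \<sqsubset> s \<and> s \<sqsubset> g u"
        then obtain i where "i < j" "g l \<sqsubset> g i" "g i \<sqsubset> g u" using j'(1) less_Suc_eq_le by blast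
        then show False using j(2)[of i] t_mono unfolding P_def by blast
      qed
    qed (use initial H j' in auto)
    \<comment> \<open>Up to stage \<open>j\<close> the midpoint is the only value inside, so both
      halves are still empty at that stage.\<close>
    have only: "i = j" if "i \<le> j" "t (g l) < t (g i)" "t (g i) < t (g u)" for i
      using j(2)[of i] that by (auto simp: P_def order_le_less)
    have lu: "l \<le> j" "u \<le> j" "t (g l) < t (g j)" "t (g j) < t (g u)"
      using H(1,2) j' j(1) by (auto simp: P_def)
    show ?thesis
    proof (cases "t (g j) < x")
      case True
      have "\<not> (t (g j) < t (g i) \<and> t (g i) < t (g u))" if "i \<le> j" for i
        using only[OF that] lu by auto
      moreover have "t (g u) - t (g j) \<le> d / 2" using mid H(6) by (simp add: field_simps)
      ultimately show ?thesis using True H(4) lu(2) order_refl[of j] by blast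
    next
      case False
      then have "x < t (g j)" using xS[of j] by simp
      moreover have "\<not> (t (g l) < t (g i) \<and> t (g i) < t (g j))" if "i \<le> j" for i
        using only[OF that] lu by auto
      moreover have "t (g j) - t (g l) \<le> d / 2" using mid H(6) by (simp add: field_simps)
      ultimately show ?thesis using H(3) lu(1) order_refl[of j] by blast
    qed
  qed
  have "\<exists>k l u. l \<le> k \<and> u \<le> k \<and> t (g l) < x \<and> x < t (g u) \<and>
      (\<forall>i\<le>k. \<not> (t (g l) < t (g i) \<and> t (g i) < t (g u))) \<and> t (g u) - t (g l) \<le> D / 2 ^ n" for n
  proof (induction n)
    case 0
    \<comment> \<open>The initial bracket consists of the values nearest to \<open>x\<close> among
      those with index at most \<open>k\<close>; it is no wider than \<open>D\<close>.\<close>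
    define k where "k = max l0 u0"
    define V where "V = (\<lambda>i. t (g i)) ` {..k}"
    have V: "finite V" by (simp add: V_def)
    have "t (g l0) \<in> V" "t (g u0) \<in> V" by (auto simp: V_def k_def)
    then have mem: "t (g l0) \<in> {v\<in>V. v < x}" "t (g u0) \<in> {v\<in>V. x < v}"
      using l0 u0 by simp_all
    have fin: "finite {v\<in>V. v < x}" "finite {v\<in>V. x < v}" using V by simp_all
    have L: "Max {v\<in>V. v < x} \<in> {v\<in>V. v < x}" "t (g l0) \<le> Max {v\<in>V. v < x}"
      using Max_in[OF fin(1)] Max_ge[OF fin(1) mem(1)] mem(1) by blast+
    have U: "Min {v\<in>V. x < v} \<in> {v\<in>V. x < v}" "Min {v\<in>V. x < v} \<le> t (g u0)"
      using Min_in[OF fin(2)] Min_le[OF fin(2) mem(2)] mem(2) by blast+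
    from L(1) U(1) obtain l u where lu: "l \<le> k" "u \<le> k" "t (g l) = Max {v\<in>V. v < x}" "t (g u) = Min {v\<in>V. x < v}"
      by (auto simp: V_def)
    have "\<not> (t (g l) < t (g i) \<and> t (g i) < t (g u))" if "i \<le> k" for i
    proof -
      have "t (g i) \<in> V" using that by (auto simp: V_def)
      then have "t (g i) < x \<Longrightarrow> t (g i) \<le> t (g l)" "x < t (g i) \<Longrightarrow> t (g u) \<le> t (g i)"
        using V by (auto simp: lu intro: Max_ge Min_le)
      then show ?thesis using xS[of i] by linarith
    qed
    moreover have "t (g l) < x" "x < t (g u)" using L U lu by auto
    moreover have "t (g u) - t (g l) \<le> D / 2 ^ 0" using L U lu by (simp add: D_def)
    ultimately show ?case using lu(1,2) by blast
  next
    case (Suc n)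
    then show ?case using step[where d = "D / 2 ^ n"] by (simp add: field_simps) metis
  qed
  \<comment> \<open>The lower ends of the brackets approach \<open>x\<close>, although
    \<open>x\<close> has a positive distance \<open>e\<close> from all values.\<close>
  then have small: "\<exists>l. t (g l) < x \<and> x - t (g l) < D / 2 ^ n" for n
    by (smt (verit))
  obtain e where e: "e > 0" "\<forall>y\<in>t ` A. e \<le> dist y x"
    using x by (metis closure_approachable not_le)
  have "(\<lambda>n. D / 2 ^ n) \<longlonglongrightarrow> 0"
    by (rule LIMSEQ_divide_realpow_zero) simp
  then have "\<forall>\<^sub>F n in sequentially. D / 2 ^ n < e" using e(1) by (rule order_tendstoD)
  then obtain n where "D / 2 ^ n < e" by (auto simp: eventually_sequentially)
  moreover obtain l where "t (g l) < x" "x - t (g l) < D / 2 ^ n" using small by blast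
  moreover have "e \<le> dist (t (g l)) x" using e(2) g_in by blast
  ultimately show False by (simp add: dist_real_def)
qed

end

section \<open>Crossings and the Conrad property\<close>

text \<open>Otherwise the iterates decrease to a limit in the closed interval from \<open>y\<close>
  to \<open>x\<close>, and continuity makes this limit a fixed point.\<close>

lemma iterates_pass_below:
  fixes f :: "real \<Rightarrow> real"
  assumes cont: "continuous_on UNIV f" and down: "\<And>z. y \<le> z \<Longrightarrow> z \<le> x \<Longrightarrow> f z < z"
  shows "\<exists>k. (f ^^ k) x < y"
proof (rule ccontr)
  assume "\<nexists>k. (f ^^ k) x < y"
  then have ge: "y \<le> (f ^^ k) x" for k by (simp add: not_less)
  have le: "(f ^^ k) x \<le> x" for k
  proof (induction k)
    case (Suc k)
    then show ?case using down[OF ge Suc] by simp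
  qed simp
  have "decseq (\<lambda>k. (f ^^ k) x)"
    using down[OF ge le] by (intro decseq_SucI) (simp add: order_less_imp_le)
  then obtain l where l: "(\<lambda>k. (f ^^ k) x) \<longlonglongrightarrow> l"
    using decseq_convergent[of "\<lambda>k. (f ^^ k) x" y] ge by blast
  have "(\<lambda>k. f ((f ^^ k) x)) \<longlonglongrightarrow> f l"
    using continuous_on_tendsto_compose[OF cont l] by simp
  moreover have "(\<lambda>k. f ((f ^^ k) x)) \<longlonglongrightarrow> l"
    using LIMSEQ_Suc[OF l] by simp
  ultimately have "f l = l" by (rule LIMSEQ_unique)
  moreover have "y \<le> l" "l \<le> x"
    using LIMSEQ_le_const[OF l] LIMSEQ_le_const2[OF l] ge le by blast+
  ultimately show False using down by force
qed

text \<open>Conjugation with the reflection of the line reduces this to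
  \<open>iterates_pass_below\<close>.\<close>

lemma iterates_pass_above:
  fixes f :: "real \<Rightarrow> real"
  assumes cont: "continuous_on UNIV f" and up: "\<And>z. x \<le> z \<Longrightarrow> z \<le> y \<Longrightarrow> z < f z"
  shows "\<exists>k. y < (f ^^ k) x"
proof -
  have "((\<lambda>z. - f (- z)) ^^ k) (- x) = - (f ^^ k) x" for k
    by (induction k) auto
  moreover have "continuous_on UNIV (\<lambda>z. - f (- z))"
    using cont by (intro continuous_intros continuous_on_compose2[OF cont]) auto
  ultimately show ?thesis
    using iterates_pass_below[of "\<lambda>z. - f (- z)" "- y" "- x"] up by (auto simp: minus_less_iff)
qed

lemma no_fixpoint_sign:
  fixes f :: "real \<Rightarrow> real"
  assumes cont: "continuous_on UNIV f" and I: "is_interval I" and nofix: "\<And>x. x \<in> I \<Longrightarrow> f x \<noteq> x"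
  shows "(\<forall>x\<in>I. f x < x) \<or> (\<forall>x\<in>I. x < f x)"
proof (rule ccontr)
  assume "\<not> ?thesis"
  then obtain x y where xy: "x \<in> I" "y \<in> I" "f x - x \<ge> 0" "f y - y \<le> 0"
    by (auto simp: not_less)
  have "connected ((\<lambda>x. f x - x) ` I)"
    using I is_interval_connected_1
    by (intro connected_continuous_image continuous_intros continuous_on_subset[OF cont]) auto
  then have "0 \<in> (\<lambda>x. f x - x) ` I"
    using xy connectedD_interval[of "(\<lambda>x. f x - x) ` I" "f y - y" "f x - x" 0] by auto
  then show False using nofix by force
qed

text \<open>The last assumption is the Conrad condition seen from an orbit point \<open>s\<close>;
  it speaks only of maps that move \<open>s\<close> to the right.\<close>

locale conrad_action =
  fixes H :: "(real \<Rightarrow> real) set" and S :: "real set"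
  assumes comp: "f \<in> H \<Longrightarrow> h \<in> H \<Longrightarrow> f \<circ> h \<in> H"
    and id: "id \<in> H"
    and inverse: "f \<in> H \<Longrightarrow> \<exists>f'\<in>H. f \<circ> f' = id \<and> f' \<circ> f = id"
    and mono: "f \<in> H \<Longrightarrow> strict_mono f"
    and cont: "f \<in> H \<Longrightarrow> continuous_on UNIV f"
    and invariant: "f \<in> H \<Longrightarrow> s \<in> S \<Longrightarrow> f s \<in> S"
    and conrad: "f \<in> H \<Longrightarrow> h \<in> H \<Longrightarrow> s \<in> S \<Longrightarrow> s < f s \<Longrightarrow> s < h s \<Longrightarrow>
      \<exists>n. h s < f ((h ^^ n) s)"
begin

lemma funpow: "f \<in> H \<Longrightarrow> f ^^ n \<in> H"
  using id by (induction n) (auto intro: comp simp: id_def)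

lemma funpow_invariant: "f \<in> H \<Longrightarrow> s \<in> S \<Longrightarrow> (f ^^ n) s \<in> S"
  using funpow invariant by blast

lemma less_iff: "f \<in> H \<Longrightarrow> f x < f y \<longleftrightarrow> x < y"
  using mono strict_mono_less by blast

lemma le_iff: "f \<in> H \<Longrightarrow> f x \<le> f y \<longleftrightarrow> x \<le> y"
  using mono strict_mono_less_eq by blast

text \<open>The iterates of \<open>G\<close> at \<open>s\<close> never get past \<open>c\<close>, so
  \<open>F c\<close> bounds all the values among which \<open>conrad\<close> finds one above
  \<open>G s\<close>.\<close>

lemma no_trap:
  assumes "F \<in> H" "G \<in> H" "s \<in> S" "s < F s" "s < G s" "s \<le> c" "G c \<le> c"
  shows "G s < F c"
proof -
  obtain n where n: "G s < F ((G ^^ n) s)" using conrad assms by blast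
  have "(G ^^ n) s \<le> c"
  proof (induction n)
    case (Suc n)
    then have "G ((G ^^ n) s) \<le> G c" using le_iff assms by blast
    with assms(7) show ?case by simp
  qed (use assms in simp)
  then have "F ((G ^^ n) s) \<le> F c" using le_iff assms by blast
  with n show ?thesis by simp
qed

text \<open>Only the real endpoint \<open>a\<close> is named, so the right end of \<open>I\<close>
  may be infinite. The role of \<open>c\<close> in \<open>no_trap\<close> is played by a point of
  \<open>I\<close> just above \<open>g a\<close>.\<close>

lemma no_cross_at_left:
  assumes f: "f \<in> H" and g: "g \<in> H" and I: "is_interval I" "open I"
    and inv: "\<And>x. f x \<in> I \<longleftrightarrow> x \<in> I" and down: "\<And>x. x \<in> I \<Longrightarrow> f x < x"
    and a: "f a = a" "\<And>x. x \<in> I \<Longrightarrow> a < x" "\<And>x y. a < x \<Longrightarrow> x < y \<Longrightarrow> y \<in> I \<Longrightarrow> x \<in> I"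
    and ga: "g a \<in> I" and s0: "s0 \<in> S" "s0 \<in> I"
  shows False
proof -
  have fx: "(f ^^ k) x \<in> I" if "x \<in> I" for k x
    using that inv by (induction k) auto
  have fa: "(f ^^ k) a = a" for k using a(1) by (induction k) auto
  have push: "\<exists>k. (f ^^ k) x < y" if "x \<in> I" "y \<in> I" for x y
    using iterates_pass_below[OF cont[OF f]] down I(1) that
    by (meson is_interval_1)
  obtain c where c: "g a < c" "c \<in> I"
  proof -
    obtain d where "g a < d" "{g a..<d} \<subseteq> I" using open_right[OF I(2) ga, of "g a + 1"] by auto
    then show thesis using that[of "(g a + d) / 2"] by (auto simp: subset_iff)
  qed
  obtain j where "(f ^^ j) s0 < g a" using push s0 ga by blast
  then obtain s where s: "s \<in> S" "s \<in> I" "s < g a"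
    using funpow_invariant[OF f] fx s0 by blast
  obtain g' where g': "g' \<in> H" "g \<circ> g' = id" "g' \<circ> g = id" using inverse[OF g] by blast
  have "a < g' c" using c less_iff[OF g'(1), of "g a" c] g'(3) by (metis comp_apply id_apply)
  \<comment> \<open>Pushing \<open>c\<close> below this \<open>y\<close>, hence below the preimage
    of \<open>c\<close> under \<open>g\<close>, makes \<open>g \<circ> f ^^ k\<close> move
    \<open>c\<close> down.\<close>
  then obtain y where y: "a < y" "y < g' c" "y \<in> I"
    using a(3)[of _ c] c(2) a(2)[of c]
    by (metis dense order_less_trans linorder_neqE)
  obtain k where "(f ^^ k) c < y" using push c(2) y(3) by blast
  then have "g ((f ^^ k) c) < g (g' c)" using less_iff[OF g] y by auto
  then have k: "g ((f ^^ k) c) < c" using g'(2) by (metis comp_apply id_apply)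
  \<comment> \<open>This \<open>N\<close> puts the image of \<open>c\<close> under
    \<open>g \<circ> f ^^ N\<close> below that of \<open>s\<close> under
    \<open>g \<circ> f ^^ k\<close>, contrary to \<open>no_trap\<close>.\<close>
  obtain N where N: "(f ^^ N) c < (f ^^ k) s" using push fx c(2) s(2) by blast
  have gt: "s < g ((f ^^ i) s)" for i
  proof -
    have "(f ^^ i) a < (f ^^ i) s" using less_iff[OF funpow[OF f]] a(2) s by blast
    then have "g a < g ((f ^^ i) s)" using less_iff[OF g] fa by simp
    with s show ?thesis by simp
  qed
  have "(g \<circ> f ^^ k) s < (g \<circ> f ^^ N) c"
  proof (rule no_trap[of "g \<circ> f ^^ N" "g \<circ> f ^^ k"])
    show "g \<circ> f ^^ k \<in> H" "g \<circ> f ^^ N \<in> H" using comp g funpow[OF f] by blast+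
  qed (use s gt k c in auto)
  then show False using N less_iff[OF g] by force
qed

lemma no_cross_at_right:
  assumes f: "f \<in> H" and g: "g \<in> H" and I: "is_interval I"
    and inv: "\<And>x. f x \<in> I \<longleftrightarrow> x \<in> I" and up: "\<And>x. x \<in> I \<Longrightarrow> x < f x"
    and b: "f b = b" "\<And>x. x \<in> I \<Longrightarrow> x < b" "\<And>x y. x < b \<Longrightarrow> y < x \<Longrightarrow> y \<in> I \<Longrightarrow> x \<in> I"
    and gb: "g b \<in> I" and s0: "s0 \<in> S" "s0 \<in> I"
  shows False
proof -
  obtain f' where f': "f' \<in> H" "f \<circ> f' = id" "f' \<circ> f = id" using inverse[OF f] by blast
  have ff: "f (f' x) = x" "f' (f x) = x" for x
    using f' by (metis comp_apply id_apply)+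
  have inv': "f' x \<in> I \<longleftrightarrow> x \<in> I" for x using inv[of "f' x"] ff by simp
  have down: "f' x < x" if "x \<in> I" for x
    using up[of "f' x"] inv' that ff by simp
  have fx: "(f ^^ k) x \<in> I" "(f' ^^ k) x \<in> I" if "x \<in> I" for k x
    using that inv inv' by (induction k) auto
  have fb: "(f ^^ k) b = b" for k using b by (induction k) auto
  have seg: "z \<in> I" if "x \<in> I" "y \<in> I" "x \<le> z" "z \<le> y" for x y z
    using I that by (meson is_interval_1)
  have push: "\<exists>k. (f' ^^ k) x < y" if "x \<in> I" "y \<in> I" for x y
    using iterates_pass_below[OF cont[OF f'(1)]] down seg that by meson
  have pull: "\<exists>k. y < (f ^^ k) x" if "x \<in> I" "y \<in> I" for x y
    using iterates_pass_above[OF cont[OF f]] up seg that by meson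
  \<comment> \<open>This is the value at \<open>b\<close> of the map taken as \<open>F\<close> in
    \<open>no_trap\<close>, whatever the exponent \<open>m\<close>.\<close>
  define w where "w = f' (g b)"
  have w: "w \<in> I" "w < g b" using gb inv' down by (auto simp: w_def)
  obtain j where "(f' ^^ j) s0 < w" using push s0 w by blast
  then obtain s where s: "s \<in> S" "s \<in> I" "s < w"
    using funpow_invariant[OF f'(1)] fx s0 by blast
  \<comment> \<open>The iterates of \<open>f\<close> at \<open>s\<close> pass every point of
    \<open>I\<close>, so their images under \<open>g\<close> pass every point below
    \<open>g b\<close>.\<close>
  have reach: "\<exists>k. y < g ((f ^^ k) s)" if "y < g b" for y
  proof -
    obtain g' where g': "g' \<in> H" "g \<circ> g' = id" "g' \<circ> g = id" using inverse[OF g] by blast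
    have gg: "g (g' x) = x" "g' (g x) = x" for x using g' by (metis comp_apply id_apply)+
    have "g' y < b" using that less_iff[OF g'(1), of y "g b"] gg by simp
    \<comment> \<open>The point \<open>g' y\<close> may lie to the left of \<open>I\<close>; in that
      case \<open>s\<close> serves as \<open>z\<close>.\<close>
    then obtain z where z: "g' y \<le> z" "z \<in> I"
      using b(3)[of "g' y" s] s(2) by (metis linorder_not_le order_refl order_less_imp_le)
    obtain k where "z < (f ^^ k) s" using pull s(2) z(2) by blast
    then have "g (g' y) < g ((f ^^ k) s)" using z less_iff[OF g] by auto
    then show ?thesis using gg by auto
  qed
  obtain k where k: "w < g ((f ^^ k) s)" using reach w by blast
  have "f s < g b" using s(3) less_iff[OF f, of s w] ff by (simp add: w_def)
  then obtain m where "f s < g ((f ^^ m) s)" using reach by blast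
  then have m: "s < f' (g ((f ^^ m) s))" using less_iff[OF f'(1), of "f s"] ff by simp
  have "(g \<circ> f ^^ k) s < (f' \<circ> (g \<circ> f ^^ m)) b"
  proof (rule no_trap[of "f' \<circ> (g \<circ> f ^^ m)" "g \<circ> f ^^ k"])
    show "g \<circ> f ^^ k \<in> H" "f' \<circ> (g \<circ> f ^^ m) \<in> H" using comp g funpow[OF f] f' by blast+
    show "s \<le> b" "(g \<circ> f ^^ k) b \<le> b" using b(2) s(2) gb fb by (simp_all add: order_less_imp_le)
  qed (use s k m in auto)
  then show False using k fb by (simp add: w_def)
qed

text \<open>The assumption \<open>meets\<close> yields an orbit point in the interval, where
  \<open>conrad\<close> can be applied. Passing to the inverse of \<open>f\<close> where necessary
  gives a map that moves points towards the endpoint displaced by \<open>g\<close>.\<close>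

lemma no_cross:
  assumes f: "f \<in> H" and g: "g \<in> H"
    and meets: "\<And>I z. is_interval I \<Longrightarrow> z \<in> I \<Longrightarrow> f z \<in> I \<Longrightarrow> f z \<noteq> z \<Longrightarrow> I \<inter> S \<noteq> {}"
  shows "\<not> crosses_on f g a b"
proof
  assume cr: "crosses_on f g a b"
  then have "a < b" by (simp add: crosses_on_def)
  have fixp: "extend_ereal f x = x \<longleftrightarrow> x = a \<or> x = b" if "a \<le> x" "x \<le> b" for x
    using cr that by (auto simp: crosses_on_def)
  define I where "I = {x. a < ereal x \<and> ereal x < b}"
  have "I = ereal -` {a<..<b}" by (auto simp: I_def)
  then have "open I" by (simp add: open_ereal_vimage)
  have int: "is_interval I"
    unfolding is_interval_1 I_def Ball_def mem_Collect_eq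
    by (meson ereal_less_eq(3) le_less_trans less_le_trans)
  have nofix: "f x \<noteq> x" if "x \<in> I" for x
    using fixp[of "ereal x", OF order_less_imp_le order_less_imp_le] that by (auto simp: I_def extend_ereal_def)
  have fa: "extend_ereal f a = a" and fb: "extend_ereal f b = b"
    using fixp \<open>a < b\<close> by auto
  have inv: "f x \<in> I \<longleftrightarrow> x \<in> I" for x
  proof -
    have "a < ereal (f x) \<longleftrightarrow> a < ereal x"
    proof (cases a)
      case (real q)
      then show ?thesis using fa less_iff[OF f, of q x] by (simp add: extend_ereal_def)
    qed auto
    moreover have "ereal (f x) < b \<longleftrightarrow> ereal x < b"
    proof (cases b)
      case (real q)
      then show ?thesis using fb less_iff[OF f, of x q] by (simp add: extend_ereal_def)
    qed auto
    ultimately show ?thesis by (simp add: I_def)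
  qed
  obtain f' where f': "f' \<in> H" "f \<circ> f' = id" "f' \<circ> f = id" using inverse[OF f] by blast
  have ff: "f (f' x) = x" "f' (f x) = x" for x
    using f' by (metis comp_apply id_apply)+
  have inv': "f' x \<in> I \<longleftrightarrow> x \<in> I" for x using inv[of "f' x"] ff by simp
  obtain z where "z \<in> I" using \<open>a < b\<close> ereal_dense2 by (auto simp: I_def)
  then obtain s where s: "s \<in> S" "s \<in> I" using meets[OF int, of z] inv nofix by blast
  have "(\<forall>x\<in>I. f x < x) \<or> (\<forall>x\<in>I. x < f x)"
    using no_fixpoint_sign[OF cont[OF f] int] nofix by blast
  \<comment> \<open>Of \<open>f\<close> and its inverse, \<open>h\<close> is the one that moves
    \<open>I\<close> down and \<open>h'\<close> the one that moves it up.\<close>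
  then obtain h h' where h: "h \<in> H" "h' \<in> H" "{h, h'} = {f, f'}" "\<And>x. x \<in> I \<Longrightarrow> h x < x"
    "\<And>x. x \<in> I \<Longrightarrow> x < h' x"
  proof
    assume *: "\<forall>x\<in>I. f x < x"
    moreover have "x < f' x" if "x \<in> I" for x using * that ff[of x] inv' by metis
    ultimately show thesis using that[of f f'] f f' by blast
  next
    assume *: "\<forall>x\<in>I. x < f x"
    moreover have "f' x < x" if "x \<in> I" for x using * that ff[of x] inv' by metis
    ultimately show thesis using that[of f' f] f f' by blast
  qed
  have invh: "h x \<in> I \<longleftrightarrow> x \<in> I" "h' x \<in> I \<longleftrightarrow> x \<in> I" for x
    using h(3) inv inv' by (auto simp: doubleton_eq_iff)
  have fixh: "h x = x \<and> h' x = x" if "f x = x" for x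
    using that h(3) ff(2)[of x] by (auto simp: doubleton_eq_iff)
  from cr consider "extend_ereal g a \<in> {a<..<b}" | "extend_ereal g b \<in> {a<..<b}"
    by (auto simp: crosses_on_def)
  then show False
  proof cases
    case 1
    \<comment> \<open>An infinite endpoint is fixed by every extended map, so the endpoint that
      \<open>g\<close> displaces is real.\<close>
    then obtain a' where a': "a = ereal a'" using \<open>a < b\<close> by (cases a) (auto simp: extend_ereal_def)
    show False
    proof (rule no_cross_at_left[OF h(1) g int \<open>open I\<close> invh(1) h(4)])
      show "h a' = a'" using fa fixh by (simp add: a' extend_ereal_def)
      show "g a' \<in> I" using 1 by (simp add: a' I_def extend_ereal_def)
      show "x \<in> I" if "a' < x" "x < y" "y \<in> I" for x y
        using that less_trans[of "ereal x" "ereal y" b] by (simp add: a' I_def)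
    qed (use s in \<open>auto simp: a' I_def\<close>)
  next
    case 2
    then obtain b' where b': "b = ereal b'" using \<open>a < b\<close> by (cases b) (auto simp: extend_ereal_def)
    show False
    proof (rule no_cross_at_right[OF h(2) g int invh(2) h(5)])
      show "h' b' = b'" using fb fixh by (simp add: b' extend_ereal_def)
      show "g b' \<in> I" using 2 by (simp add: b' I_def extend_ereal_def)
      show "x \<in> I" if "x < b'" "y < x" "y \<in> I" for x y
        using that less_trans[of a "ereal y" "ereal x"] by (simp add: b' I_def)
    qed (use s in \<open>auto simp: b' I_def\<close>)
  qed
qed

end

section \<open>The group of the dynamical realization\<close>

locale ordered_group = group G for G :: "('a, 'b) monoid_scheme" (structure) +
  fixes r :: "('a \<times> 'a) set" and g :: "nat \<Rightarrow> 'a"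
  assumes left_invariant: "left_invariant_order G r"
    and nontrivial: "carrier G \<noteq> {\<one>}"
    and is_numbering: "numbering (carrier G) g"

sublocale ordered_group \<subseteq> strict_linear_order "carrier G" r
  using left_invariant by unfold_locales (simp add: left_invariant_order_def)

context ordered_group
begin

lemma lt_mult:
  assumes "x \<sqsubset> y" "h \<in> carrier G"
  shows "h \<otimes> x \<sqsubset> h \<otimes> y"
proof -
  have xy: "x \<in> carrier G" "y \<in> carrier G" using lt_in assms(1) by auto
  then have "h \<otimes> x = h \<otimes> y \<longleftrightarrow> x = y" using assms(2) by simp
  then show ?thesis
    using assms xy left_invariant
    unfolding strictly_def left_invariant_order_def by blast
qed

lemma lt_mult_iff:
  assumes "x \<in> carrier G" "y \<in> carrier G" "h \<in> carrier G"
  shows "h \<otimes> x \<sqsubset> h \<otimes> y \<longleftrightarrow> x \<sqsubset> y"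
proof
  assume "h \<otimes> x \<sqsubset> h \<otimes> y"
  then have "inv h \<otimes> (h \<otimes> x) \<sqsubset> inv h \<otimes> (h \<otimes> y)" using lt_mult assms by blast
  then show "x \<sqsubset> y" using assms by (simp add: m_assoc[symmetric])
qed (use lt_mult assms in blast)

lemma positive_exists: "\<exists>p. \<one> \<sqsubset> p"
proof -
  obtain x where x: "x \<in> carrier G" "x \<noteq> \<one>" using nontrivial by blast
  have "x \<sqsubset> \<one> \<Longrightarrow> \<one> \<sqsubset> inv x" using lt_mult[of x \<one> "inv x"] x by simp
  then show ?thesis using lt_linear[of x \<one>] x by blast
qed

text \<open>Multiply \<open>x\<close> on the right by a positive element or by its inverse.\<close>

lemma no_extrema:
  assumes "x \<in> carrier G"
  shows "\<exists>y. x \<sqsubset> y" "\<exists>y. y \<sqsubset> x"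
proof -
  obtain p where p: "\<one> \<sqsubset> p" using positive_exists by blast
  then have "p \<in> carrier G" using lt_in by blast
  then show "\<exists>y. x \<sqsubset> y" "\<exists>y. y \<sqsubset> x"
    using lt_mult[OF p assms] lt_mult[OF lt_mult[OF p, of "inv p"] assms] assms by auto
qed

text \<open>Hence the numbering runs over all naturals, as \<open>unbounded_numbered_order\<close>
  demands.\<close>

lemma infinite_carrier: "infinite (carrier G)"
  using finite_has_greatest[of "carrier G"] no_extrema(1) lt_in lt_asym lt_irrefl one_closed
  by (metis empty_iff order_refl)

end

sublocale ordered_group \<subseteq> unbounded_numbered_order "carrier G" r g
  using is_numbering infinite_carrier no_extrema by unfold_locales (simp_all add: numbering_def)

context ordered_group
begin

abbreviation "S \<equiv> t ` carrier G"

definition "left_shift h y = t (h \<otimes> inv_into (carrier G) t y)"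

abbreviation "act \<equiv> dynamical_action G r g"

lemma gapped_S: "gapped S"
proof
  show "\<exists>s\<in>S. s < x" for x using t_unbounded_below[of x] g_in by blast
  show "\<exists>s\<in>S. x < s" for x using t_unbounded_above[of x] g_in by blast
  show "\<exists>a b. is_gap S a b \<and> a < x \<and> x < b" if "x \<notin> closure S" for x
  proof -
    obtain l u where lu: "t (g l) < x" "x < t (g u)"
      "\<And>i. \<not> (t (g l) < t (g i) \<and> t (g i) < t (g u))"
      using t_bracket \<open>x \<notin> closure S\<close> by blast
    have "{t (g l)<..<t (g u)} \<inter> S = {}"
    proof -
      have "\<not> (t (g l) < t y \<and> t y < t (g u))" if "y \<in> carrier G" for y
        using lu(3) g_surj[OF that] by blast
      then show ?thesis by auto
    qed
    then show ?thesis using lu g_in by (intro exI[of _ "t (g l)"] exI[of _ "t (g u)"]) (auto simp: is_gap_def)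
  qed
qed

lemma left_shift_t: "x \<in> carrier G \<Longrightarrow> left_shift h (t x) = t (h \<otimes> x)"
  using inj_t by (simp add: left_shift_def)

lemma left_shift_automorphism:
  assumes h: "h \<in> carrier G"
  shows "gapped_automorphism S (left_shift h)"
proof (intro gapped_automorphism.intro gapped_S gapped_automorphism_axioms.intro)
  show "left_shift h ` S = S"
  proof
    show "S \<subseteq> left_shift h ` S"
    proof
      fix y assume "y \<in> S"
      then obtain x where x: "x \<in> carrier G" "y = t x" by blast
      then have "y = left_shift h (t (inv h \<otimes> x))"
        using h by (simp add: left_shift_t m_assoc[symmetric])
      then show "y \<in> left_shift h ` S" using h x(1) by blast
    qed
  qed (use h left_shift_t in auto)
  show "strict_mono_on S (left_shift h)"
    using h by (auto simp: strict_mono_on_def left_shift_t t_less_iff lt_mult)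
qed

lemma act_eq: "act h = gapped_automorphism.ext S (left_shift h)" if "h \<in> carrier G"
  using nontrivial gapped_automorphism.ext_def[OF left_shift_automorphism[OF that]]
  by (simp add: dynamical_action_def left_shift_def[abs_def] Let_def)

lemma act_t: "h \<in> carrier G \<Longrightarrow> x \<in> carrier G \<Longrightarrow> act h (t x) = t (h \<otimes> x)"
  using gapped_automorphism.ext_eq[OF left_shift_automorphism] by (simp add: act_eq left_shift_t)

lemma act_mult:
  assumes "h \<in> carrier G" "k \<in> carrier G"
  shows "act (h \<otimes> k) = act h \<circ> act k"
proof -
  have "left_shift (h \<otimes> k) s = left_shift h (left_shift k s)" if "s \<in> S" for s
    using that assms by (auto simp: left_shift_t m_assoc)
  then show ?thesis
    using ext_comp[OF left_shift_automorphism left_shift_automorphism left_shift_automorphism]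
    by (simp add: act_eq assms)
qed

lemma act_one: "act \<one> = id"
  using gapped_automorphism.ext_id[OF left_shift_automorphism[OF one_closed]]
  by (force simp: act_eq left_shift_t)

lemma act_inv:
  assumes "h \<in> carrier G"
  shows "act h \<circ> act (inv h) = id" "act (inv h) \<circ> act h = id"
  using act_mult[of h "inv h"] act_mult[of "inv h" h] assms by (simp_all add: act_one)

lemma act_pow: "h \<in> carrier G \<Longrightarrow> act (h [^] n) = act h ^^ (n::nat)"
  by (induction n) (simp_all add: act_one act_mult funpow_Suc_right del: funpow.simps(2))

lemma strict_mono_act: "h \<in> carrier G \<Longrightarrow> strict_mono (act h)"
  using gapped_automorphism.strict_mono_ext[OF left_shift_automorphism] by (simp add: act_eq)

text \<open>A monotone map with open range is continuous, and the inverse element makes the range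
  all of the line.\<close>

lemma continuous_act:
  assumes "h \<in> carrier G"
  shows "continuous_on UNIV (act h)"
proof (rule continuous_onI_mono)
  have "surj (act h)" using act_inv(1)[OF assms] by (metis comp_apply id_apply surjI)
  then show "open (range (act h))" by simp
  show "act h x \<le> act h y" if "x \<le> y" for x y
    using strict_mono_act[OF assms] that by (simp add: strict_mono_less_eq)
qed

lemma act_Homeo_plus:
  assumes "h \<in> carrier G"
  shows "act h \<in> carrier Homeo_plus"
proof -
  have "act h (act (inv h) x) = x" "act (inv h) (act h x) = x" for x
    using act_inv[OF assms] by (metis comp_apply id_apply)+
  then have "homeomorphism UNIV UNIV (act h) (act (inv h))"
    using continuous_act assms by (intro homeomorphismI) auto
  then show ?thesis using strict_mono_act[OF assms] by (auto simp: Homeo_plus_def)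
qed

lemma realization_subgroup: "subgroup (dynamical_realization G r g) Homeo_plus"
proof
  interpret H: group Homeo_plus by (rule group_Homeo_plus)
  show "dynamical_realization G r g \<subseteq> carrier Homeo_plus"
    using act_Homeo_plus by (auto simp: dynamical_realization_def)
  show "x \<otimes>\<^bsub>Homeo_plus\<^esub> y \<in> dynamical_realization G r g"
    if "x \<in> dynamical_realization G r g" "y \<in> dynamical_realization G r g" for x y
    using that by (auto simp: dynamical_realization_def Homeo_plus_def act_mult[symmetric])
  show "\<one>\<^bsub>Homeo_plus\<^esub> \<in> dynamical_realization G r g"
    using act_one by (force simp: dynamical_realization_def Homeo_plus_def)
  show "inv\<^bsub>Homeo_plus\<^esub> x \<in> dynamical_realization G r g"
    if x: "x \<in> dynamical_realization G r g" for x
  proof -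
    obtain h where h: "h \<in> carrier G" "x = act h" using x by (auto simp: dynamical_realization_def)
    then have "inv\<^bsub>Homeo_plus\<^esub> x = act (inv h)"
      using act_inv(2)[of h] act_Homeo_plus by (intro H.inv_equality) (auto simp: Homeo_plus_def)
    then show ?thesis using h by (simp add: dynamical_realization_def)
  qed
qed

text \<open>The order is invariant on the left only, so at \<open>s = t k\<close> the Conrad
  condition is applied to the conjugates of \<open>a\<close> and \<open>b\<close> by
  \<open>k\<close>, and the result is multiplied by \<open>k\<close> on the left.\<close>

lemma realization_conrad_action:
  assumes "conrad_order G r"
  shows "conrad_action (dynamical_realization G r g) S"
proof
  note real = dynamical_realization_def
  fix f assume "f \<in> dynamical_realization G r g"
  then obtain a where a: "a \<in> carrier G" "f = act a" by (auto simp: real)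
  show "\<exists>f'\<in>dynamical_realization G r g. f \<circ> f' = id \<and> f' \<circ> f = id"
    using a act_inv[OF a(1)] by (auto simp: real)
  show "strict_mono f" "continuous_on UNIV f"
    using a strict_mono_act continuous_act by auto
  show "f s \<in> S" if "s \<in> S" for s
    using that a by (auto simp: act_t)
  fix h assume "h \<in> dynamical_realization G r g"
  then obtain b where b: "b \<in> carrier G" "h = act b" by (auto simp: real)
  show "f \<circ> h \<in> dynamical_realization G r g"
    using a b by (auto simp: real act_mult[symmetric])
  fix s assume "s \<in> S" and lt: "s < f s" "s < h s"
  then obtain k where k: "k \<in> carrier G" "s = t k" by blast
  define c where "c x = inv k \<otimes> (x \<otimes> k)" for x
  have c: "c x \<in> carrier G" "k \<otimes> c x = x \<otimes> k" if "x \<in> carrier G" for x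
    using that k by (simp_all add: c_def m_assoc[symmetric])
  have pos: "\<one> \<sqsubset> c x" if "x \<in> carrier G" "s < act x s" for x
  proof -
    have "k \<otimes> \<one> \<sqsubset> k \<otimes> c x" using that k c by (simp add: act_t t_less_iff)
    then show ?thesis using lt_mult_iff[of \<one> "c x" k] c that k by simp
  qed
  have "\<one> \<sqsubset> c a" "\<one> \<sqsubset> c b" using pos a b lt by auto
  then obtain n :: nat where n: "c b \<sqsubset> c a \<otimes> c b [^] n"
    using assms c(1) a(1) b(1) unfolding conrad_order_def by blast
  \<comment> \<open>Moving \<open>k\<close> past a power of the conjugate turns it into the same
    power of \<open>b\<close>.\<close>
  have pow: "k \<otimes> c b [^] n = b [^] n \<otimes> k" for n :: nat
  proof (induction n)
    case (Suc n)
    have "k \<otimes> (c b [^] n \<otimes> c b) = (k \<otimes> c b [^] n) \<otimes> c b"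
      using k c(1) b by (simp add: m_assoc)
    also have "\<dots> = b [^] n \<otimes> (k \<otimes> c b)"
      using Suc k c(1) b by (simp add: m_assoc)
    also have "\<dots> = b [^] n \<otimes> b \<otimes> k"
      using k c b by (simp add: m_assoc)
    finally show ?case by simp
  qed (use k in simp)
  have "k \<otimes> c b \<sqsubset> k \<otimes> (c a \<otimes> c b [^] n)" using lt_mult[OF n k(1)] .
  also have "k \<otimes> (c a \<otimes> c b [^] n) = (k \<otimes> c a) \<otimes> c b [^] n"
    using k c(1) a b by (simp add: m_assoc)
  also have "\<dots> = a \<otimes> (k \<otimes> c b [^] n)"
    using k c a b by (simp add: m_assoc)
  also have "\<dots> = a \<otimes> (b [^] n \<otimes> k)"
    by (simp add: pow)
  finally have "b \<otimes> k \<sqsubset> a \<otimes> (b [^] n \<otimes> k)" using c b by simp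
  then have "h s < f ((h ^^ n) s)"
    using a b k by (simp add: act_pow[symmetric] act_t t_less_iff)
  then show "\<exists>n. h s < f ((h ^^ n) s)" by blast
next
  show "id \<in> dynamical_realization G r g"
    using act_one by (force simp: dynamical_realization_def)
qed

text \<open>The assumption \<open>meets\<close> of \<open>no_cross\<close> holds because left
  multiplication by \<open>k \<noteq> \<one>\<close> has no fixed point, so
  \<open>moved_interval_meets\<close> applies.\<close>

lemma realization_not_crossed:
  assumes "conrad_order G r"
  shows "without_crossed_elements (dynamical_realization G r g)"
proof -
  interpret conrad_action "dynamical_realization G r g" S
    using realization_conrad_action assms .
  have "\<not> crosses_on f h a b"
    if f: "f \<in> dynamical_realization G r g" and h: "h \<in> dynamical_realization G r g" for f h a b
  proof (rule no_cross[OF f h])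
    fix I z assume I: "is_interval I" "z \<in> I" "f z \<in> I" "f z \<noteq> z"
    obtain k where k: "k \<in> carrier G" "f = act k" using f by (auto simp: dynamical_realization_def)
    interpret gapped_automorphism S "left_shift k" using left_shift_automorphism k(1) .
    have "k \<noteq> \<one>" using I(4) k act_one by auto
    have "left_shift k s \<noteq> s" if s: "s \<in> S" for s
    proof -
      obtain x where x: "x \<in> carrier G" "s = t x" using s by blast
      then have "k \<otimes> x \<noteq> x" using \<open>k \<noteq> \<one>\<close> k(1) by simp
      then show ?thesis using inj_t x k(1) by (simp add: left_shift_t inj_on_eq_iff)
    qed
    then show "I \<inter> S \<noteq> {}"
      using moved_interval_meets[of I z] I k by (simp add: act_eq)
  qed
  then show ?thesis by (auto simp: without_crossed_elements_def crossed_on_def)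
qed

end

theorem proposition3p14:
  fixes \<Gamma> :: "('a, 'b) monoid_scheme" and r :: "('a \<times> 'a) set" and g :: "nat \<Rightarrow> 'a"
  assumes "group \<Gamma>"
    and "countable (carrier \<Gamma>)"
    and "conrad_order \<Gamma> r"
    and "numbering (carrier \<Gamma>) g"
  shows "subgroup (dynamical_realization \<Gamma> r g) Homeo_plus \<and>
         without_crossed_elements (dynamical_realization \<Gamma> r g)"
proof (cases "carrier \<Gamma> = {\<one>\<^bsub>\<Gamma>\<^esub>}")
  \<comment> \<open>For the trivial group \<open>t\<close> has a single value and its image is
    bounded, so this case is separate: \<open>id\<close> sends no endpoint into the open
    interval.\<close>
  case True
  then have trivial: "dynamical_realization \<Gamma> r g = {id}"
    by (simp add: dynamical_realization_def dynamical_action_def)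
  have "subgroup {id} Homeo_plus"
    using group.triv_subgroup[OF group_Homeo_plus] by (simp add: Homeo_plus_def)
  moreover have "extend_ereal id x = x" for x
    by (cases x) (simp_all add: extend_ereal_def)
  ultimately show ?thesis
    by (simp add: trivial without_crossed_elements_def crossed_on_def crosses_on_def)
next
  case False
  with assms interpret ordered_group \<Gamma> r g
    by (simp add: ordered_group_def ordered_group_axioms_def conrad_order_def)
  show ?thesis using realization_subgroup realization_not_crossed assms(3) by blast
qed

end
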